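(* Let $(X,\hookrightarrow,\mathcal{P})$ be a primal-proximity space. Then the operator $cl^{*}:2^X\to 2^X$ defined by $cl^{*}(A):=A\cup\overset{\hookrightarrow}{A}$ satisfies the Kuratowski closure axioms and induces a topology $\tau^{*}$ on $X$ given by $\tau^{*}=\{A\subseteq X : cl^{*}(A^{c})=A^{c}\}$.
   Context: $A^c$ denotes $X\setminus A$. A primal on a non-empty set $X$ is a collection $\mathcal{P}\subseteq 2^X$ such that (i) $X\notin\mathcal{P}$; (ii) if $A\in\mathcal{P}$ and $B\subseteq A$, then $B\in\mathcal{P}$; (iii) if $A\cap B\in\mathcal{P}$, then $A\in\mathcal{P}$ or $B\in\mathcal{P}$. A primal-proximity space $(X,\hookrightarrow,\mathcal{P})$ is a non-empty set $X$ with a primal $\mathcal{P}$ on $X$ and a binary relation $\hookrightarrow$ on $2^X$ such that for all $A,B,C\subseteq X$: (1) if $A\hookrightarrow B$, then $B\hookrightarrow A$; (2) $A\hookrightarrow (B\cup C)$ iff $A\hookrightarrow B$ or $A\hookrightarrow C$; (3) if $A^c\notin\mathcal{P}$, then $A\not\hookrightarrow B$ for all $B\subseteq X$; (4) if $(A\cap B)^c\in\mathcal{P}$, then $A\hookrightarrow B$; (5) if $A\not\hookrightarrow B$, then there exist $C,D\subseteq X$ such that $A\not\hookrightarrow C^c$, $D^c\not\hookrightarrow B$ and $(C\cap D)^c\notin\mathcal{P}$. For $A\subseteq X$, $\overset{\hookrightarrow}{A}:=\{x\in X : \{x\}\hookrightarrow A\}$. The Kuratowski closure axioms for an operator $\Phi:2^X\to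 2^X$ are: (1) $\Phi(\emptyset)=\emptyset$; (2) $A\subseteq\Phi(A)$ for all $A\subseteq X$; (3) $\Phi(A\cup B)=\Phi(A)\cup\Phi(B)$ for all $A,B\subseteq X$; (4) $\Phi(\Phi(A))=\Phi(A)$ for all $A\subseteq X$. *)

theory Defs
  imports "HOL-Analysis.Analysis"
begin

definition primal_on :: "'a set \<Rightarrow> 'a set set \<Rightarrow> bool" where
  "primal_on X P \<longleftrightarrow>
     X \<noteq> {} \<and>
     P \<subseteq> Pow X \<and>
     X \<notin> P \<and>
     (\<forall>A B. A \<in> P \<and> B \<subseteq> A \<longrightarrow> B \<in> P) \<and>
     (\<forall>A B. A \<subseteq> X \<and> B \<subseteq> X \<and> A \<inter> B \<in> P \<longrightarrow> A \<in> P \<or> B \<in> P)"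

text \<open>
  A relation on the power set of \<open>X\<close> is represented by a binary predicate on sets; only its values
  on subsets of \<open>X\<close> matter. Complements are relative to \<open>X\<close>.
\<close>

definition primal_proximity_space ::
    "'a set \<Rightarrow> ('a set \<Rightarrow> 'a set \<Rightarrow> bool) \<Rightarrow> 'a set set \<Rightarrow> bool" where
  "primal_proximity_space X near P \<longleftrightarrow>
     primal_on X P \<and>
     (\<forall>A B. A \<subseteq> X \<and> B \<subseteq> X \<and> near A B \<longrightarrow> near B A) \<and>
     (\<forall>A B C. A \<subseteq> X \<and> B \<subseteq> X \<and> C \<subseteq> X \<longrightarrow>
        (near A (B \<union> C) \<longleftrightarrow> near A B \<or> near A C)) \<and>
     (\<forall>A. A \<subseteq> X \<and> X - A \<notin> P \<longrightarrow> (\<forall>B. B \<subseteq> X \<longrightarrow> \<not> near A B)) \<and>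
     (\<forall>A B. A \<subseteq> X \<and> B \<subseteq> X \<and> X - (A \<inter> B) \<in> P \<longrightarrow> near A B) \<and>
     (\<forall>A B. A \<subseteq> X \<and> B \<subseteq> X \<and> \<not> near A B \<longrightarrow>
        (\<exists>C D. C \<subseteq> X \<and> D \<subseteq> X \<and> \<not> near A (X - C) \<and> \<not> near (X - D) B \<and>
               X - (C \<inter> D) \<notin> P))"

definition near_points :: "'a set \<Rightarrow> ('a set \<Rightarrow> 'a set \<Rightarrow> bool) \<Rightarrow> 'a set \<Rightarrow> 'a set" where
  "near_points X near A = {x \<in> X. near {x} A}"

definition cl_star :: "'a set \<Rightarrow> ('a set \<Rightarrow> 'a set \<Rightarrow> bool) \<Rightarrow> 'a set \<Rightarrow> 'a set" where
  "cl_star X near A = A \<union> near_points X near A"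

definition kuratowski_closure_on :: "'a set \<Rightarrow> ('a set \<Rightarrow> 'a set) \<Rightarrow> bool" where
  "kuratowski_closure_on X \<Phi> \<longleftrightarrow>
     \<Phi> \<in> Pow X \<rightarrow> Pow X \<and>
     \<Phi> {} = {} \<and>
     (\<forall>A. A \<subseteq> X \<longrightarrow> A \<subseteq> \<Phi> A) \<and>
     (\<forall>A B. A \<subseteq> X \<and> B \<subseteq> X \<longrightarrow> \<Phi> (A \<union> B) = \<Phi> A \<union> \<Phi> B) \<and>
     (\<forall>A. A \<subseteq> X \<longrightarrow> \<Phi> (\<Phi> A) = \<Phi> A)"

definition tau_star :: "'a set \<Rightarrow> ('a set \<Rightarrow> 'a set \<Rightarrow> bool) \<Rightarrow> 'a set set" where
  "tau_star X near = {A. A \<subseteq> X \<and> cl_star X near (X - A) = X - A}"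

end

theory Submission
  imports Defs
begin

text \<open>
  The only closure axiom that is not immediate is idempotence, which amounts to: if \<open>{x}\<close> is far
  from \<open>A\<close>, then it is far from the set \<open>N\<close> of points near \<open>A\<close>. Take \<open>C, D\<close> separating \<open>{x}\<close>
  from \<open>A\<close>. A point outside \<open>D\<close> is far from \<open>A\<close>, so \<open>N \<subseteq> D = (D - C) \<union> (C \<inter> D)\<close>. Here
  \<open>D - C\<close> is far from \<open>{x}\<close> because \<open>X - C\<close> is, and \<open>C \<inter> D\<close> is far from everything.
\<close>

lemma kuratowski_closure_onD:
  assumes "kuratowski_closure_on X \<Phi>"
  shows "A \<subseteq> X \<Longrightarrow> \<Phi> A \<subseteq> X"
    and "\<Phi> {} = {}"
    and "A \<subseteq> X \<Longrightarrow> A \<subseteq> \<Phi> A"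
    and "A \<subseteq> X \<Longrightarrow> B \<subseteq> X \<Longrightarrow> \<Phi> (A \<union> B) = \<Phi> A \<union> \<Phi> B"
    and "A \<subseteq> X \<Longrightarrow> \<Phi> (\<Phi> A) = \<Phi> A"
  using assms by (auto simp: kuratowski_closure_on_def Pi_iff)

text \<open>Additivity suffices: \<open>B = A \<union> B\<close>, so \<open>\<Phi> A\<close> is one
  of the two pieces of \<open>\<Phi> B\<close>.\<close>

lemma kuratowski_closure_on_mono:
  assumes K: "kuratowski_closure_on X \<Phi>" and "A \<subseteq> B" "B \<subseteq> X"
  shows "\<Phi> A \<subseteq> \<Phi> B"
  using kuratowski_closure_onD(4)[OF K, of A B] assms(2,3) by (metis Un_upper1 order_trans sup.absorb2)

text \<open>Passing to complements, binary intersections follow from additivity by De Morgan, while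
  arbitrary unions need only monotonicity and extensivity. Idempotence does not enter until the
  closure is identified.\<close>

lemma istopology_kuratowski_closure_on:
  assumes K: "kuratowski_closure_on X \<Phi>"
  shows "istopology (\<lambda>U. U \<subseteq> X \<and> \<Phi> (X - U) = X - U)"
  unfolding istopology_def
proof (intro conjI allI impI)
  fix S T assume S: "S \<subseteq> X \<and> \<Phi> (X - S) = X - S" and T: "T \<subseteq> X \<and> \<Phi> (X - T) = X - T"
  then show "S \<inter> T \<subseteq> X" by blast
  show "\<Phi> (X - S \<inter> T) = X - S \<inter> T"
    using S T kuratowski_closure_onD(4)[OF K, of "X - S" "X - T"] by (simp add: Diff_Int)
next
  fix \<K> assume op: "\<forall>U\<in>\<K>. U \<subseteq> X \<and> \<Phi> (X - U) = X - U"
  then show "\<Union>\<K> \<subseteq> X" by blast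
  have "\<Phi> (X - \<Union>\<K>) \<subseteq> X - U" if "U \<in> \<K>" for U
  proof -
    have "\<Phi> (X - \<Union>\<K>) \<subseteq> \<Phi> (X - U)"
      by (rule kuratowski_closure_on_mono[OF K]) (use that in auto)
    then show ?thesis using op that by simp
  qed
  \<comment> \<open>The bound by \<open>X\<close> covers the empty family, for which no
    \<open>U\<close> is available; extensivity gives the reverse inclusion.\<close>
  moreover have "\<Phi> (X - \<Union>\<K>) \<subseteq> X" "X - \<Union>\<K> \<subseteq> \<Phi> (X - \<Union>\<K>)"
    by (simp_all add: kuratowski_closure_onD[OF K])
  ultimately show "\<Phi> (X - \<Union>\<K>) = X - \<Union>\<K>" by blast
qed

text \<open>The closed sets are exactly the fixed points of \<open>\<Phi>\<close>. By idempotence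
  \<open>\<Phi> A\<close> is one of them, and by monotonicity it is the least one containing
  \<open>A\<close>.\<close>

lemma topology_kuratowski_closure_on:
  fixes X :: "'a set"
  assumes K: "kuratowski_closure_on X \<Phi>"
  defines "T \<equiv> topology (\<lambda>U. U \<subseteq> X \<and> \<Phi> (X - U) = X - U)"
  shows "topspace T = X" and "A \<subseteq> X \<Longrightarrow> T closure_of A = \<Phi> A"
proof -
  have opn: "openin T U \<longleftrightarrow> U \<subseteq> X \<and> \<Phi> (X - U) = X - U" for U
    unfolding T_def using istopology_kuratowski_closure_on[OF K]
    by (simp add: topology_inverse')
  \<comment> \<open>Since \<open>X - X\<close> is empty, this is the axiom
    \<open>\<Phi> {} = {}\<close>.\<close>
  have "openin T X"
    using K by (simp add: opn kuratowski_closure_on_def)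
  then show top: "topspace T = X"
    using opn openin_topspace[of T] openin_subset by blast
  have clo: "closedin T C \<longleftrightarrow> C \<subseteq> X \<and> \<Phi> C = C" for C
    by (auto simp: closedin_def top opn double_diff)
  assume A: "A \<subseteq> X"
  have Ph: "A \<subseteq> \<Phi> A" "\<Phi> A \<subseteq> X" "\<Phi> (\<Phi> A) = \<Phi> A"
    by (simp_all add: kuratowski_closure_onD[OF K] A)
  show "T closure_of A = \<Phi> A"
  proof (rule closure_of_unique)
    show "A \<subseteq> \<Phi> A" "closedin T (\<Phi> A)" using Ph by (simp_all add: clo)
    fix C assume "A \<subseteq> C" "closedin T C"
    then show "\<Phi> A \<subseteq> C"
      using kuratowski_closure_on_mono[OF K, of A C] by (simp add: clo)
  qed
qed

locale primal_proximity =
  fixes X :: "'a set" and near :: "'a set \<Rightarrow> 'a set \<Rightarrow> bool" and P :: "'a set set"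
  assumes space: "primal_proximity_space X near P"
begin

lemma near_sym: "A \<subseteq> X \<Longrightarrow> B \<subseteq> X \<Longrightarrow> near A B \<Longrightarrow> near B A"
  using space by (simp add: primal_proximity_space_def)

lemma near_Un:
  "A \<subseteq> X \<Longrightarrow> B \<subseteq> X \<Longrightarrow> C \<subseteq> X \<Longrightarrow> near A (B \<union> C) \<longleftrightarrow> near A B \<or> near A C"
  using space by (simp add: primal_proximity_space_def)

lemma not_near_if_compl_notin:
  "A \<subseteq> X \<Longrightarrow> X - A \<notin> P \<Longrightarrow> B \<subseteq> X \<Longrightarrow> \<not> near A B"
  using space by (simp add: primal_proximity_space_def)

lemma not_near_separation:
  assumes "A \<subseteq> X" "B \<subseteq> X" "\<not> near A B"
  obtains C D where "C \<subseteq> X" "D \<subseteq> X" "\<not> near A (X - C)" "\<not> near (X - D) B" "X - (C \<inter> D) \<notin> P"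
proof -
  have "\<forall>A B. A \<subseteq> X \<and> B \<subseteq> X \<and> \<not> near A B \<longrightarrow>
      (\<exists>C D. C \<subseteq> X \<and> D \<subseteq> X \<and> \<not> near A (X - C) \<and> \<not> near (X - D) B \<and> X - (C \<inter> D) \<notin> P)"
    using space unfolding primal_proximity_space_def by (elim conjE)
  with assms that show thesis by metis
qed

lemma near_mono_right:
  "A \<subseteq> X \<Longrightarrow> C \<subseteq> X \<Longrightarrow> B \<subseteq> C \<Longrightarrow> near A B \<Longrightarrow> near A C"
  using near_Un[of A B C] by (simp add: Un_absorb1 subset_trans)

lemma near_mono_left:
  "C \<subseteq> X \<Longrightarrow> B \<subseteq> X \<Longrightarrow> A \<subseteq> C \<Longrightarrow> near A B \<Longrightarrow> near C B"
  by (meson near_mono_right near_sym subset_trans)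

text \<open>The complement of \<open>{}\<close> is \<open>X\<close>, which is not in
  \<open>P\<close>, so \<open>{}\<close> as first argument is far from every subset of
  \<open>X\<close>; symmetry moves it to the second place.\<close>

lemma not_near_empty: "A \<subseteq> X \<Longrightarrow> \<not> near A {}"
proof -
  assume "A \<subseteq> X"
  moreover have "X \<notin> P"
    using space by (simp add: primal_proximity_space_def primal_on_def)
  ultimately show ?thesis
    using near_sym[of A "{}"] not_near_if_compl_notin[of "{}" A] by auto
qed

lemma near_points_subset: "near_points X near A \<subseteq> X"
  by (auto simp: near_points_def)

lemma near_points_Un:
  "A \<subseteq> X \<Longrightarrow> B \<subseteq> X \<Longrightarrow>
    near_points X near (A \<union> B) = near_points X near A \<union> near_points X near B"
  by (auto simp: near_points_def near_Un)

lemma near_points_near_points: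
  assumes A: "A \<subseteq> X"
  shows "near_points X near (near_points X near A) \<subseteq> near_points X near A"
proof
  let ?N = "near_points X near A"
  fix x assume "x \<in> near_points X near ?N"
  then have x: "{x} \<subseteq> X" and xN: "near {x} ?N" by (auto simp: near_points_def)
  have "near {x} A"
  proof (rule ccontr)
    assume "\<not> near {x} A"
    then obtain C D where CD: "C \<subseteq> X" "D \<subseteq> X" "\<not> near {x} (X - C)" "\<not> near (X - D) A"
        "X - (C \<inter> D) \<notin> P"
      by (rule not_near_separation[OF x A])
    have "?N \<subseteq> D"
      using near_mono_left[of "X - D" A] CD(4) A by (auto simp: near_points_def)
    then have "near {x} D" using near_mono_right[OF x \<open>D \<subseteq> X\<close>] xN by blast
    moreover have "D = (D - C) \<union> (C \<inter> D)" by blast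
    ultimately have "near {x} (D - C) \<or> near {x} (C \<inter> D)"
      using near_Un[OF x, of "D - C" "C \<inter> D"] \<open>D \<subseteq> X\<close> by fastforce
    moreover have "\<not> near {x} (D - C)"
      using near_mono_right[OF x, of "X - C" "D - C"] CD(2,3) by blast
    moreover have "\<not> near {x} (C \<inter> D)"
      using near_sym[OF x, of "C \<inter> D"] not_near_if_compl_notin[of "C \<inter> D" "{x}"] CD x by blast
    ultimately show False by blast
  qed
  then show "x \<in> ?N" using x by (simp add: near_points_def)
qed

lemma kuratowski_closure_on_cl_star: "kuratowski_closure_on X (cl_star X near)"
  unfolding kuratowski_closure_on_def
proof (intro conjI allI impI)
  show "cl_star X near \<in> Pow X \<rightarrow> Pow X"
    using near_points_subset by (auto simp: cl_star_def)
  show "cl_star X near {} = {}"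
    by (auto simp: cl_star_def near_points_def not_near_empty)
  fix A
  show "A \<subseteq> cl_star X near A" by (simp add: cl_star_def)
  \<comment> \<open>With \<open>N\<close> for the points near \<open>A\<close>, those near
    \<open>A \<union> N\<close> are \<open>N\<close> together with the points near \<open>N\<close>,
    and the latter lie in \<open>N\<close> again.\<close>
  show "cl_star X near (cl_star X near A) = cl_star X near A" if "A \<subseteq> X"
    using near_points_near_points[OF that] near_points_Un[OF that near_points_subset]
    by (auto simp: cl_star_def)
next
  fix A B assume "A \<subseteq> X \<and> B \<subseteq> X"
  then show "cl_star X near (A \<union> B) = cl_star X near A \<union> cl_star X near B"
    by (auto simp: cl_star_def near_points_Un)
qed

end

text \<open>\<open>topology\<close> inverts \<open>openin\<close> only on predicates satisfying
  \<open>istopology\<close>, hence the separate conjunct. That \<open>cl_star\<close> induces the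
  topology is read in the strong sense: the closure operator of the topology gives it back.\<close>

theorem theorem5p7:
  fixes X :: "'a set" and near :: "'a set \<Rightarrow> 'a set \<Rightarrow> bool" and P :: "'a set set"
  assumes "primal_proximity_space X near P"
  shows "kuratowski_closure_on X (cl_star X near) \<and>
         istopology (\<lambda>U. U \<in> tau_star X near) \<and>
         topspace (topology (\<lambda>U. U \<in> tau_star X near)) = X \<and>
         (\<forall>A. A \<subseteq> X \<longrightarrow>
            topology (\<lambda>U. U \<in> tau_star X near) closure_of A = cl_star X near A)"
proof -
  interpret primal_proximity X near P by (unfold_locales) (rule assms)
  note K = kuratowski_closure_on_cl_star
  show ?thesis
    \<comment> \<open>Unfolding \<open>tau_star\<close> turns membership into the predicate of the
      general lemmas, with \<open>cl_star X near\<close> for \<open>\<Phi>\<close>.\<close>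
    using K istopology_kuratowski_closure_on[OF K] topology_kuratowski_closure_on[OF K]
    by (simp add: tau_star_def)
qed

end
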